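(* Let $2\le k<v$ be integers. If there exists a $\mathrm{BIBD}(v,k,1)$, then there exists a centered ETF of $v(r+1)$ vectors for $\mathbb{C}^b$, where $r=\frac{v-1}{k-1}$ and $b=\frac{v(v-1)}{k(k-1)}$. Moreover, if there exists a real Hadamard matrix of size $r+1$, this ETF can be chosen to be real, that is, to be a centered ETF of $v(r+1)$ vectors for $\mathbb{R}^b$.
   Context: Let $\mathbb{F}\in\{\mathbb{R},\mathbb{C}\}$. For vectors $\{\varphi_i\}_{i=1}^n$ in $\mathbb{F}^m$, the synthesis operator $\Phi$ is the $m\times n$ matrix whose $i$th column is $\varphi_i$. The sequence is an equiangular tight frame (ETF) for $\mathbb{F}^m$ if every $\varphi_i$ has unit norm, $|\langle\varphi_i,\varphi_j\rangle|$ is constant over all $i\neq j$, and $\Phi\Phi^*=\alpha I$ for some $\alpha>0$ (necessarily $\alpha=\frac nm$). An ETF is centered if the all-ones vector $\mathbf{1}$ lies in the null space of $\Phi$, i.e. $\sum_i\varphi_i=\mathbf{0}$. A $\mathrm{BIBD}(v,k,1)$ with $2\le k<v$ is a $v$-element set $\mathcal{V}$ together with a set $\mathcal{B}$ of $k$-element subsets of $\mathcal{V}$ (called blocks) such that every element of $\mathcal{V}$ lies in the same number $r$ of blocks, and every pair of distinct elements of $\mathcal{V}$ is contained in exactly one block. Necessarily $r=\frac{v-1}{k-1}$, and the number of blocks is $b=\frac{v(v-1)}{k(k-1)}$. A real Hadamard matrix of size $N$ is an $N\times N$ matrix with entries $\pm1$ and orthogonal rows. *)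

theory Defs
  imports
    "HOL-Analysis.L2_Norm"
    "Jordan_Normal_Form.Schur_Decomposition"
begin

text \<open>
  Vectors of \<open>F^m\<close> are elements of \<^term>\<open>carrier_vec m\<close>, and a sequence
  of \<open>n\<close> vectors is a function on \<^typ>\<open>nat\<close> of which only the values at
  indices below \<open>n\<close> matter. The definitions are generic in the scalar type;
  the types of interest are \<^typ>\<open>real\<close> and \<^typ>\<open>complex\<close>.
\<close>

definition synthesis :: "nat \<Rightarrow> nat \<Rightarrow> (nat \<Rightarrow> 'a vec) \<Rightarrow> 'a mat" where
  "synthesis m n \<phi> = mat_of_cols m (map \<phi> [0..<n])"

definition vec_l2_norm :: "'a :: real_normed_vector vec \<Rightarrow> real" where
  "vec_l2_norm x = L2_set (\<lambda>i. norm (x $ i)) {..<dim_vec x}"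

definition etf ::
  "nat \<Rightarrow> nat \<Rightarrow> (nat \<Rightarrow> 'a :: {real_normed_field, conjugatable_field} vec) \<Rightarrow> bool" where
  "etf m n \<phi> \<longleftrightarrow>
     (\<forall>i<n. \<phi> i \<in> carrier_vec m) \<and>
     (\<forall>i<n. vec_l2_norm (\<phi> i) = 1) \<and>
     (\<exists>c. \<forall>i<n. \<forall>j<n. i \<noteq> j \<longrightarrow> norm (\<phi> i \<bullet>c \<phi> j) = c) \<and>
     (\<exists>\<alpha>::real. \<alpha> > 0 \<and>
        synthesis m n \<phi> * mat_adjoint (synthesis m n \<phi>) = of_real \<alpha> \<cdot>\<^sub>m 1\<^sub>m m)"

definition centered_etf ::
  "nat \<Rightarrow> nat \<Rightarrow> (nat \<Rightarrow> 'a :: {real_normed_field, conjugatable_field} vec) \<Rightarrow> bool" where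
  "centered_etf m n \<phi> \<longleftrightarrow>
     etf m n \<phi> \<and> synthesis m n \<phi> *\<^sub>v vec n (\<lambda>_. 1) = 0\<^sub>v m"

text \<open>A \<open>BIBD(v,k,1)\<close> on the point set \<open>V\<close> with set of blocks \<open>\<B>\<close>.\<close>

definition bibd1 :: "'p set \<Rightarrow> 'p set set \<Rightarrow> nat \<Rightarrow> nat \<Rightarrow> bool" where
  "bibd1 V \<B> v k \<longleftrightarrow>
     2 \<le> k \<and> k < v \<and>
     finite V \<and> card V = v \<and>
     (\<forall>B\<in>\<B>. B \<subseteq> V \<and> card B = k) \<and>
     (\<exists>r. \<forall>x\<in>V. card {B \<in> \<B>. x \<in> B} = r) \<and>
     (\<forall>x\<in>V. \<forall>y\<in>V. x \<noteq> y \<longrightarrow> (\<exists>!B. B \<in> \<B> \<and> x \<in> B \<and> y \<in> B))"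

definition real_hadamard :: "nat \<Rightarrow> real mat \<Rightarrow> bool" where
  "real_hadamard N H \<longleftrightarrow>
     H \<in> carrier_mat N N \<and>
     (\<forall>i<N. \<forall>j<N. H $$ (i, j) = 1 \<or> H $$ (i, j) = -1) \<and>
     (\<forall>i<N. \<forall>j<N. i \<noteq> j \<longrightarrow> row H i \<bullet> row H j = 0)"

text \<open>
  When a \<open>BIBD(v,k,1)\<close> exists, \<open>(v - 1) / (k - 1)\<close> and
  \<open>v (v - 1) / (k (k - 1))\<close> are integers, namely the replication number and
  the number of blocks, so these quotients may be written with \<open>div\<close>.
\<close>

lemma bibd1_finite_blocks:
  assumes "bibd1 V \<B> v k"
  shows "finite \<B>"
proof (rule finite_subset)
  show "\<B> \<subseteq> Pow V" using assms by (auto simp: bibd1_def)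
  show "finite (Pow V)" using assms by (simp add: bibd1_def)
qed

lemma bibd1_repl_mult:
  assumes D: "bibd1 V \<B> v k" and x: "x \<in> V"
  shows "card {B \<in> \<B>. x \<in> B} * (k - 1) = v - 1"
proof -
  let ?R = "{B \<in> \<B>. x \<in> B}"
  have fin: "finite V" "finite \<B>" using D bibd1_finite_blocks[OF D] by (simp_all add: bibd1_def)
  have sub: "B \<subseteq> V" "card B = k" if "B \<in> \<B>" for B using D that by (auto simp: bibd1_def)
  have uniq: "\<exists>!B. B \<in> \<B> \<and> x \<in> B \<and> y \<in> B" if "y \<in> V" "y \<noteq> x" for y
    using D x that by (auto simp: bibd1_def)
  have cover: "(\<Union>B\<in>?R. B - {x}) = V - {x}"
  proof
    show "V - {x} \<subseteq> (\<Union>B\<in>?R. B - {x})" using uniq by blast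
    show "(\<Union>B\<in>?R. B - {x}) \<subseteq> V - {x}" using sub by blast
  qed
  have disj: "(B - {x}) \<inter> (C - {x}) = {}" if "B \<in> ?R" "C \<in> ?R" "B \<noteq> C" for B C
    using that sub uniq by blast
  have "v - 1 = card (V - {x})" using D x fin by (simp add: bibd1_def)
  also have "\<dots> = (\<Sum>B\<in>?R. card (B - {x}))"
    unfolding cover[symmetric]
    by (rule card_UN_disjoint) (use fin sub disj in \<open>auto intro: finite_subset\<close>)
  also have "\<dots> = (\<Sum>B\<in>?R. k - 1)"
    by (rule sum.cong) (use fin sub in \<open>auto simp: finite_subset\<close>)
  finally show ?thesis by simp
qed

lemma bibd1_repl:
  assumes D: "bibd1 V \<B> v k" and x: "x \<in> V"
  shows "card {B \<in> \<B>. x \<in> B} = (v - 1) div (k - 1)"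
    and "real ((v - 1) div (k - 1)) = (real v - 1) / (real k - 1)"
proof -
  have k: "2 \<le> k" "k < v" using D by (auto simp: bibd1_def)
  show *: "card {B \<in> \<B>. x \<in> B} = (v - 1) div (k - 1)"
    using k unfolding bibd1_repl_mult[OF D x, symmetric] by simp
  have "real ((v - 1) div (k - 1)) * real (k - 1) = real (v - 1)"
    using bibd1_repl_mult[OF D x] unfolding * by (simp flip: of_nat_mult)
  then show "real ((v - 1) div (k - 1)) = (real v - 1) / (real k - 1)"
    using k by (simp add: of_nat_diff field_simps)
qed

lemma bibd1_nblocks:
  assumes D: "bibd1 V \<B> v k"
  shows "card \<B> = (v * (v - 1)) div (k * (k - 1))"
    and "real ((v * (v - 1)) div (k * (k - 1))) = (real v * (real v - 1)) / (real k * (real k - 1))"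
proof -
  have k: "2 \<le> k" "k < v" using D by (auto simp: bibd1_def)
  have fin: "finite V" "finite \<B>" using D bibd1_finite_blocks[OF D] by (simp_all add: bibd1_def)
  have sub: "B \<subseteq> V" "card B = k" if "B \<in> \<B>" for B using D that by (auto simp: bibd1_def)
  have cV: "card V = v" using D by (simp add: bibd1_def)
  have "card \<B> * k = (\<Sum>B\<in>\<B>. card {x \<in> V. x \<in> B})"
  proof -
    have "{x \<in> V. x \<in> B} = B" if "B \<in> \<B>" for B using sub(1)[OF that] by auto
    then show ?thesis using sub by simp
  qed
  also have "\<dots> = (\<Sum>x\<in>V. card {B \<in> \<B>. x \<in> B})"
    using sum_multicount_gen[of \<B> V "\<lambda>B x. x \<in> B" "\<lambda>x. card {B \<in> \<B>. x \<in> B}"] fin by simp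
  finally have "card \<B> * k * (k - 1) = (\<Sum>x\<in>V. card {B \<in> \<B>. x \<in> B} * (k - 1))"
    by (simp add: sum_distrib_right)
  also have "\<dots> = v * (v - 1)" using bibd1_repl_mult[OF D] cV by simp
  finally have m: "card \<B> * (k * (k - 1)) = v * (v - 1)" by (simp add: mult.assoc)
  show *: "card \<B> = (v * (v - 1)) div (k * (k - 1))"
    using k unfolding m[symmetric] by simp
  have "real ((v * (v - 1)) div (k * (k - 1))) * (real k * real (k - 1)) = real v * real (v - 1)"
    using m unfolding * by (simp flip: of_nat_mult)
  then show "real ((v * (v - 1)) div (k * (k - 1))) = (real v * (real v - 1)) / (real k * (real k - 1))"
    using k by (simp add: of_nat_diff field_simps)
qed

end

theory Submission
  imports Defs
begin

text \<open>
  The construction is that of Steiner ETFs. Take a Hadamard matrix of size \<open>r + 1\<close> with an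
  all-ones row and delete that row. Each point \<open>x\<close> of the design lies on \<open>r\<close> blocks; assign the
  \<open>r\<close> remaining rows bijectively to these blocks, and let the \<open>r + 1\<close> columns, supported
  on the blocks through \<open>x\<close> and scaled by \<open>1 / sqrt r\<close>, be the vectors of \<open>x\<close>. Two vectors of the
  same point have inner product \<open>- 1 / r\<close> because the deleted row contributes \<open>1\<close> to a vanishing
  sum; vectors of different points overlap in the single common block and so have inner product of
  modulus \<open>1 / r\<close>. Tightness is the orthogonality of the rows, and the frame is centered because
  every remaining row is orthogonal to the deleted one.
\<close>

section \<open>From families over finite index sets to frames\<close>

lemma mat_adjoint_carrier:
  "A \<in> carrier_mat n m \<Longrightarrow> mat_adjoint A \<in> carrier_mat m n"
  by (auto simp: mat_adjoint_def mat_of_rows_def)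

lemma index_mat_adjoint:
  assumes "A \<in> carrier_mat n m" "i < m" "j < n"
  shows "mat_adjoint A $$ (i, j) = conjugate (A $$ (j, i))"
  using assms by (auto simp: mat_adjoint_def mat_of_rows_def)

text \<open>This lets a construction keep its natural index sets, here pairs of a point and a column
  for the vectors and blocks for the coordinates. Enumerating \<open>I\<close> and \<open>S\<close>
  by bijections changes none of the sums, and injectivity carries the conditions
  \<open>i \<noteq> j\<close> and \<open>s = t\<close> over to the indices.\<close>

lemma centered_etf_of_family:
  fixes f :: "'i \<Rightarrow> 's \<Rightarrow> 'a :: {real_normed_field, conjugatable_field}"
  assumes fin: "finite I" "finite S"
    and unit: "\<And>i. i \<in> I \<Longrightarrow> (\<Sum>s\<in>S. (norm (f i s))\<^sup>2) = 1"
    and equi: "\<And>i j. i \<in> I \<Longrightarrow> j \<in> I \<Longrightarrow> i \<noteq> j \<Longrightarrow>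
      norm (\<Sum>s\<in>S. f i s * conjugate (f j s)) = c"
    and "\<alpha> > 0"
    and tight: "\<And>s t. s \<in> S \<Longrightarrow> t \<in> S \<Longrightarrow>
      (\<Sum>i\<in>I. f i s * conjugate (f i t)) = (if s = t then of_real \<alpha> else 0)"
    and center: "\<And>s. s \<in> S \<Longrightarrow> (\<Sum>i\<in>I. f i s) = 0"
  shows "\<exists>\<phi> :: nat \<Rightarrow> 'a vec. centered_etf (card S) (card I) \<phi>"
proof -
  obtain p where p: "bij_betw p {0..<card I} I"
    using ex_bij_betw_nat_finite[OF fin(1)] by blast
  obtain q where q: "bij_betw q {0..<card S} S"
    using ex_bij_betw_nat_finite[OF fin(2)] by blast
  define m n where "m = card S" and "n = card I"
  define \<phi> where "\<phi> = (\<lambda>i. vec m (\<lambda>s. f (p i) (q s)))"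
  have pI: "p i \<in> I" if "i < n" for i using p that by (auto simp: bij_betw_def n_def)
  have qS: "q s \<in> S" if "s < m" for s using q that by (auto simp: bij_betw_def m_def)
  have p_eq: "p i = p j \<longleftrightarrow> i = j" if "i < n" "j < n" for i j
    using p that by (auto simp: bij_betw_def n_def inj_on_def)
  have q_eq: "q i = q j \<longleftrightarrow> i = j" if "i < m" "j < m" for i j
    using q that by (auto simp: bij_betw_def m_def inj_on_def)
  have sum_p: "(\<Sum>i = 0..<n. g (p i)) = sum g I" for g :: "'i \<Rightarrow> 'a"
    unfolding n_def by (rule sum.reindex_bij_betw[OF p])
  have sum_q: "(\<Sum>i = 0..<m. g (q i)) = sum g S" for g :: "'s \<Rightarrow> 'a"
    unfolding m_def by (rule sum.reindex_bij_betw[OF q])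
  have sum_q': "(\<Sum>i = 0..<m. g (q i)) = sum g S" for g :: "'s \<Rightarrow> real"
    unfolding m_def by (rule sum.reindex_bij_betw[OF q])
  have syn: "synthesis m n \<phi> \<in> carrier_mat m n"
    by (simp add: synthesis_def mat_of_cols_def)
  have syn_index: "synthesis m n \<phi> $$ (s, i) = f (p i) (q s)" if "s < m" "i < n" for s i
    using that by (simp add: synthesis_def mat_of_cols_def \<phi>_def)
  have "vec_l2_norm (\<phi> i) = 1" if "i < n" for i
    using unit[OF pI[OF that]] sum_q'[of "\<lambda>s. (norm (f (p i) s))\<^sup>2"]
    by (simp add: vec_l2_norm_def L2_set_def \<phi>_def lessThan_atLeast0)
  moreover have "norm (\<phi> i \<bullet>c \<phi> j) = c" if "i < n" "j < n" "i \<noteq> j" for i j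
    using equi[OF pI[OF that(1)] pI[OF that(2)]] p_eq[OF that(1,2)] that(3)
      sum_q[of "\<lambda>s. f (p i) s * conjugate (f (p j) s)"]
    by (simp add: scalar_prod_def \<phi>_def)
  moreover have "synthesis m n \<phi> * mat_adjoint (synthesis m n \<phi>) = of_real \<alpha> \<cdot>\<^sub>m 1\<^sub>m m"
    (is "?L = ?R")
  proof (rule eq_matI)
    fix s t assume "s < dim_row ?R" "t < dim_col ?R"
    then have st: "s < m" "t < m" by auto
    have "?L $$ (s, t) = (\<Sum>i = 0..<n. f (p i) (q s) * conjugate (f (p i) (q t)))"
      using st syn mat_adjoint_carrier[OF syn]
      by (simp add: scalar_prod_def syn_index index_mat_adjoint[OF syn])
    also have "\<dots> = (if q s = q t then of_real \<alpha> else 0)"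
      using tight[OF qS[OF st(1)] qS[OF st(2)]]
        sum_p[of "\<lambda>i. f i (q s) * conjugate (f i (q t))"] by simp
    finally show "?L $$ (s, t) = ?R $$ (s, t)" using st by (simp add: q_eq)
  qed (use syn mat_adjoint_carrier[OF syn] in auto)
  moreover have "synthesis m n \<phi> *\<^sub>v vec n (\<lambda>_. 1) = 0\<^sub>v m"
  proof (rule eq_vecI)
    fix s assume "s < dim_vec (0\<^sub>v m :: 'a vec)"
    then have s: "s < m" by simp
    then show "(synthesis m n \<phi> *\<^sub>v vec n (\<lambda>_. 1)) $ s = (0\<^sub>v m) $ s"
      using syn center[OF qS[OF s]] sum_p[of "\<lambda>i. f i (q s)"]
      by (simp add: scalar_prod_def syn_index)
  qed (use syn in simp)
  ultimately have "centered_etf m n \<phi>"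
    using \<open>\<alpha> > 0\<close> by (auto simp: centered_etf_def etf_def \<phi>_def)
  then show ?thesis unfolding m_def n_def by blast
qed

section \<open>The Steiner construction over a generic scalar field\<close>

text \<open>A (complex) Hadamard matrix of size \<open>r + 1\<close> from which an all-ones row was deleted.\<close>

definition punctured_hadamard ::
  "nat \<Rightarrow> (nat \<Rightarrow> nat \<Rightarrow> 'a :: {real_normed_field, conjugatable_field}) \<Rightarrow> bool" where
  "punctured_hadamard r h \<longleftrightarrow>
     (\<forall>i<r. \<forall>j<r + 1. norm (h i j) = 1 \<and> h i j * conjugate (h i j) = 1) \<and>
     (\<forall>i<r. \<forall>i'<r. i \<noteq> i' \<longrightarrow> (\<Sum>j<r + 1. h i j * conjugate (h i' j)) = 0) \<and>
     (\<forall>i<r. (\<Sum>j<r + 1. h i j) = 0) \<and>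
     (\<forall>j<r + 1. \<forall>j'<r + 1. j \<noteq> j' \<longrightarrow> (\<Sum>i<r. h i j * conjugate (h i j')) = - 1)"

text \<open>One argument serves both scalar fields, since the field enters only through
  \<open>h\<close> and \<open>conj_real\<close>. The latter makes the scaling factor
  \<open>1 / sqrt r\<close> self-conjugate, so that \<open>a * conjugate a\<close> is
  \<open>1 / r\<close>.\<close>

lemma steiner_centered_etf:
  fixes h :: "nat \<Rightarrow> nat \<Rightarrow> 'a :: {real_normed_field, conjugatable_field}"
  assumes D: "bibd1 V \<B> v k"
    and r: "r = (v - 1) div (k - 1)"
    and h: "punctured_hadamard r h"
    and conj_real: "\<And>x :: real. conjugate (of_real x :: 'a) = of_real x"
  shows "\<exists>\<phi> :: nat \<Rightarrow> 'a vec. centered_etf (card \<B>) (v * (r + 1)) \<phi>"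
proof -
  have k: "2 \<le> k" "k < v" using D by (auto simp: bibd1_def)
  have fin: "finite V" "finite \<B>" using D bibd1_finite_blocks[OF D] by (simp_all add: bibd1_def)
  have sub: "B \<subseteq> V" "card B = k" if "B \<in> \<B>" for B using D that by (auto simp: bibd1_def)
  have r0: "r > 0" using k unfolding r by (simp add: div_greater_zero_iff)
  have hnorm: "norm (h i j) = 1" "h i j * conjugate (h i j) = 1" if "i < r" "j < r + 1" for i j
    using h that by (auto simp: punctured_hadamard_def)
  have hrow: "(\<Sum>j<r + 1. h i j * conjugate (h i' j)) = 0" if "i < r" "i' < r" "i \<noteq> i'" for i i'
    using h that unfolding punctured_hadamard_def by blast
  have hsum: "(\<Sum>j<r + 1. h i j) = 0" if "i < r" for i
    using h that unfolding punctured_hadamard_def by blast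
  have hcol: "(\<Sum>i<r. h i j * conjugate (h i j')) = - 1" if "j < r + 1" "j' < r + 1" "j \<noteq> j'" for j j'
    using h that unfolding punctured_hadamard_def by blast
  \<comment> \<open>\<open>norm\<close> and \<open>conjugate\<close> come from unrelated type
    classes, so the modulus of the conjugate is obtained by taking norms in
    \<open>h i j * conjugate (h i j) = 1\<close>.\<close>
  have hconj: "norm (conjugate (h i j)) = 1" if "i < r" "j < r + 1" for i j
    using arg_cong[OF hnorm(2)[OF that], of norm] hnorm(1)[OF that] by (simp add: norm_mult)
  define R where "R = (\<lambda>x. {B \<in> \<B>. x \<in> B})"
  have R: "finite (R x)" "R x \<subseteq> \<B>" for x using fin by (auto simp: R_def)
  have "\<exists>g. bij_betw g (R x) {..<r}" if "x \<in> V" for x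
  proof -
    have "card (R x) = r" unfolding R_def r by (rule bibd1_repl(1)[OF D that])
    then show ?thesis using ex_bij_betw_finite_nat[OF R(1)[of x]] by (simp add: lessThan_atLeast0)
  qed
  then obtain g where g: "\<And>x. x \<in> V \<Longrightarrow> bij_betw (g x) (R x) {..<r}" by metis
  have gr: "g x B < r" if "x \<in> V" "B \<in> R x" for x B
    using g[OF that(1)] that(2) by (auto simp: bij_betw_def)
  define a :: 'a where "a = of_real (1 / sqrt r)"
  have aa: "a * conjugate a = of_real (1 / r)" "norm a = 1 / sqrt r"
    unfolding a_def conj_real using r0 by (simp_all flip: of_real_mult of_real_divide)
  have na: "norm (conjugate a) = norm a" by (simp only: a_def conj_real)
  \<comment> \<open>The bijection \<open>g x\<close> chooses which row of \<open>h\<close> the point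
    \<open>x\<close> uses on each of its blocks.\<close>
  define f where "f = (\<lambda>(x, j) B. if x \<in> B then a * h (g x B) j else 0)"
  define I where "I = V \<times> {..<r + 1}"
  have finI: "finite I" and cardI: "card I = v * (r + 1)"
    using D fin by (auto simp: I_def card_cartesian_product bibd1_def)
  have sumI: "(\<Sum>i\<in>I. G i) = (\<Sum>x\<in>V. \<Sum>j<r + 1. G (x, j))" for G :: "_ \<Rightarrow> 'a"
    by (simp only: I_def sum.cartesian_product)
      (simp add: case_prod_beta)
  have unit: "(\<Sum>B\<in>\<B>. (norm (f i B))\<^sup>2) = 1" if iI: "i \<in> I" for i
  proof -
    obtain x j where i: "i = (x, j)" and x: "x \<in> V" and j: "j < r + 1"
      using iI by (auto simp: I_def)
    have "(\<Sum>B\<in>\<B>. (norm (f i B))\<^sup>2) = (\<Sum>B\<in>R x. (norm (f i B))\<^sup>2)"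
      by (rule sum.mono_neutral_right) (auto simp: fin R_def f_def i)
    also have "\<dots> = (\<Sum>B\<in>R x. 1 / r)"
    proof (rule sum.cong[OF refl])
      fix B assume B: "B \<in> R x"
      then have "x \<in> B" by (simp add: R_def)
      then show "(norm (f i B))\<^sup>2 = 1 / r"
        using hnorm(1)[OF gr[OF x B] j]
        by (simp add: f_def i norm_mult aa power_divide)
    qed
    also have "\<dots> = 1" using bij_betw_same_card[OF g[OF x]] r0 by simp
    finally show ?thesis .
  qed
  have equi: "norm (\<Sum>B\<in>\<B>. f i B * conjugate (f i' B)) = 1 / r"
    if iI: "i \<in> I" and iI': "i' \<in> I" and ii': "i \<noteq> i'" for i i'
  proof -
    obtain x j where i: "i = (x, j)" and x: "x \<in> V" and j: "j < r + 1"
      using iI by (auto simp: I_def)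
    obtain y l where i': "i' = (y, l)" and y: "y \<in> V" and l: "l < r + 1"
      using iI' by (auto simp: I_def)
    \<comment> \<open>Only blocks through both points contribute: all of \<open>R x\<close> if the
      points agree, a single block otherwise.\<close>
    have eq: "(\<Sum>B\<in>\<B>. f i B * conjugate (f i' B)) =
        (\<Sum>B\<in>R x \<inter> R y. a * conjugate a * (h (g x B) j * conjugate (h (g y B) l)))"
    proof -
      have "(\<Sum>B\<in>\<B>. f i B * conjugate (f i' B)) = (\<Sum>B\<in>R x \<inter> R y. f i B * conjugate (f i' B))"
        by (rule sum.mono_neutral_right) (auto simp: fin R_def f_def i i')
      also have "\<dots> =
          (\<Sum>B\<in>R x \<inter> R y. a * conjugate a * (h (g x B) j * conjugate (h (g y B) l)))"
        by (rule sum.cong[OF refl])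
          (auto simp: R_def f_def i i' conjugate_dist_mul mult_ac)
      finally show ?thesis .
    qed
    show ?thesis
    proof (cases "x = y")
      case True
      with ii' i i' have "j \<noteq> l" by simp
      \<comment> \<open>As \<open>B\<close> runs over \<open>R x\<close>, the row
        \<open>g x B\<close> runs over all rows once, which leaves the inner product of two
        columns.\<close>
      have "(\<Sum>B\<in>R x. h (g x B) j * conjugate (h (g x B) l)) = (\<Sum>i<r. h i j * conjugate (h i l))"
        by (rule sum.reindex_bij_betw[OF g[OF x], of "\<lambda>i. h i j * conjugate (h i l)"])
      then show ?thesis
        unfolding eq sum_distrib_left[symmetric]
        using True hcol[OF j l \<open>j \<noteq> l\<close>] by (simp add: aa norm_divide)
    next
      case False
      with D x y have "\<exists>!B. B \<in> \<B> \<and> x \<in> B \<and> y \<in> B" by (auto simp: bibd1_def)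
      then obtain B where B: "R x \<inter> R y = {B}" unfolding R_def by blast
      then have "B \<in> R x" "B \<in> R y" by auto
      then show ?thesis
        unfolding eq B using hnorm(1)[OF gr[OF x] j] hconj[OF gr[OF y] l]
        by (simp add: aa norm_mult norm_divide)
    qed
  qed
  \<comment> \<open>The constant arises because each of the \<open>k\<close> points of a block
    contributes \<open>r + 1\<close> entries of squared modulus \<open>1 / r\<close>.\<close>
  have tight: "(\<Sum>i\<in>I. f i B * conjugate (f i C)) = (if B = C then of_real (real k * (real r + 1) / real r) else 0)"
    if B: "B \<in> \<B>" and C: "C \<in> \<B>" for B C
  proof -
    have "(\<Sum>j<r + 1. f (x, j) B * conjugate (f (x, j) C)) =
        (if B = C then of_real ((r + 1) / r) else 0)" if x: "x \<in> B" "x \<in> C" for x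
    proof -
      have xV: "x \<in> V" and RB: "B \<in> R x" and RC: "C \<in> R x" using x sub[OF B] B C by (auto simp: R_def)
      have "(\<Sum>j<r + 1. f (x, j) B * conjugate (f (x, j) C)) =
          a * conjugate a * (\<Sum>j<r + 1. h (g x B) j * conjugate (h (g x C) j))"
        unfolding sum_distrib_left
        by (rule sum.cong[OF refl]) (simp add: f_def x conjugate_dist_mul mult_ac)
      also have "(\<Sum>j<r + 1. h (g x B) j * conjugate (h (g x C) j)) = (if B = C then of_nat (r + 1) else 0)"
      proof (cases "B = C")
        case True
        then show ?thesis using hnorm(2)[OF gr[OF xV RC]] by simp
      next
        case False
        \<comment> \<open>Different blocks through \<open>x\<close> receive different rows, which
          are orthogonal.\<close>
        then have "g x B \<noteq> g x C"
          using g[OF xV] RB RC by (auto simp: bij_betw_def inj_on_def)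
        then show ?thesis using hrow[OF gr[OF xV RB] gr[OF xV RC]] False by simp
      qed
      finally show ?thesis by (simp add: aa)
    qed
    \<comment> \<open>A point outside \<open>B\<close> or \<open>C\<close> contributes zero. For
      \<open>B \<noteq> C\<close> both sides vanish, so the single test \<open>x \<in> B\<close>
      suffices.\<close>
    then have "(\<Sum>j<r + 1. f (x, j) B * conjugate (f (x, j) C)) =
        (if B = C \<and> x \<in> B then of_real ((r + 1) / r) else 0)" for x
      by (cases "x \<in> B \<and> x \<in> C") (auto simp: f_def)
    then have "(\<Sum>i\<in>I. f i B * conjugate (f i C)) =
        (\<Sum>x\<in>V. if B = C \<and> x \<in> B then of_real ((r + 1) / r) else 0)"
      unfolding sumI by presburger
    also have "\<dots> = (if B = C then \<Sum>x\<in>B. of_real ((r + 1) / r) else 0)"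
      using sub[OF B] fin by (simp add: sum.If_cases Int_absorb1)
    finally show ?thesis using sub(2)[OF B] by (auto simp: field_simps)
  qed
  \<comment> \<open>The \<open>r + 1\<close> vectors of a single point already sum to zero, by the
    vanishing row sums of \<open>h\<close>.\<close>
  have center: "(\<Sum>i\<in>I. f i B) = 0" if B: "B \<in> \<B>" for B
    unfolding sumI
  proof (rule sum.neutral, rule ballI)
    fix x assume x: "x \<in> V"
    show "(\<Sum>j<r + 1. f (x, j) B) = 0"
    proof (cases "x \<in> B")
      case True
      then have "B \<in> R x" using B by (simp add: R_def)
      have "(\<Sum>j<r + 1. f (x, j) B) = a * (\<Sum>j<r + 1. h (g x B) j)"
        unfolding sum_distrib_left by (simp add: f_def True)
      then show ?thesis using hsum[OF gr[OF x \<open>B \<in> R x\<close>]] by simp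
    qed (simp add: f_def)
  qed
  have "real k * (real r + 1) / real r > 0" using k r0 by simp
  from centered_etf_of_family[OF finI fin(2) unit equi this tight center]
  show ?thesis unfolding cardI .
qed

section \<open>Complex case: the Fourier matrix\<close>

lemma sum_power_root_unity:
  fixes z :: complex
  assumes "z ^ n = 1" "z \<noteq> 1"
  shows "(\<Sum>i<n. z ^ i) = 0"
  using geometric_sum[OF assms(2), of n] assms(1) by simp

text \<open>The witness is the discrete Fourier matrix of size \<open>r + 1\<close> without its row
  of exponent zero. All required sums reduce to geometric sums of roots of unity.\<close>

lemma punctured_hadamard_fourier:
  "\<exists>h :: nat \<Rightarrow> nat \<Rightarrow> complex. punctured_hadamard r h"
proof -
  define e where "e = (\<lambda>j. cis (2 * pi * real j / real (r + 1)))"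
  \<comment> \<open>The exponent starts at 1 because exponent 0 gives the deleted all-ones
    row.\<close>
  define h where "h = (\<lambda>i j. e j ^ (i + 1))"
  \<comment> \<open>Symmetry of the Fourier matrix turns sums along a row into geometric sums in
    \<open>j\<close>.\<close>
  have h: "h i j = e (i + 1) ^ j" for i j
    by (simp only: h_def e_def DeMoivre) (simp add: field_simps)
  have e0: "e 0 = 1" by (simp add: e_def)
  have root: "e j ^ (r + 1) = 1" for j
  proof -
    have "real (r + 1) * (2 * pi * real j / real (r + 1)) = 2 * pi * real j"
      by (simp del: of_nat_add)
    then show ?thesis unfolding e_def DeMoivre by (simp only: cis_multiple_2pi Ints_of_nat)
  qed
  have ne: "e i \<noteq> e j" if "i < r + 1" "j < r + 1" "i \<noteq> j" for i j
    using bij_betw_roots_unity[of "r + 1"] that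
    unfolding e_def bij_betw_def inj_on_def by auto
  have unit: "norm (e j) = 1" for j by (simp add: e_def)
  have unit': "e j * cnj (e j) = 1" for j using complex_norm_square[of "e j"] unit by simp
  \<comment> \<open>The quotient of two distinct roots of unity is a root of unity other than 1; its
    inverse factor is written as \<open>cnj (e j)\<close>.\<close>
  have sum0: "(\<Sum>l<r + 1. (e i * cnj (e j)) ^ l) = 0" if "i < r + 1" "j < r + 1" "i \<noteq> j" for i j
  proof (rule sum_power_root_unity)
    show "(e i * cnj (e j)) ^ (r + 1) = 1"
      by (simp only: power_mult_distrib root complex_cnj_power[symmetric] complex_cnj_one mult_1)
    show "e i * cnj (e j) \<noteq> 1"
    proof
      assume "e i * cnj (e j) = 1"
      then have "e i * (e j * cnj (e j)) = e j" by (simp add: mult_ac)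
      with unit' ne[OF that] show False by simp
    qed
  qed
  have "norm (h i j) = 1 \<and> h i j * conjugate (h i j) = 1" for i j
    by (simp only: h_def conjugate_complex_def complex_cnj_power norm_power unit unit' power_one
        simp_thms flip: power_mult_distrib)
  moreover have "(\<Sum>j<r + 1. h i j * conjugate (h i' j)) = 0" if "i < r" "i' < r" "i \<noteq> i'" for i i'
    using sum0[of "i + 1" "i' + 1"] that by (simp only: h) (simp add: power_mult_distrib)
  \<comment> \<open>A row sum is the inner product with the deleted row, which belongs to
    \<open>e 0 = 1\<close>.\<close>
  moreover have "(\<Sum>j<r + 1. h i j) = 0" if "i < r" for i
    using sum0[of "i + 1" 0] that by (simp only: h) (simp add: e0)
  moreover have "(\<Sum>i<r. h i j * conjugate (h i j')) = - 1" if "j < r + 1" "j' < r + 1" "j \<noteq> j'" for j j'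
  proof -
    have "(\<Sum>i<r. h i j * conjugate (h i j')) = (\<Sum>i<r. (e j * cnj (e j')) ^ Suc i)"
      by (simp add: h_def power_mult_distrib mult_ac)
    \<comment> \<open>The exponents here run from 1 to \<open>r\<close>; the missing term of
      exponent 0 equals 1 and completes the sum to zero.\<close>
    with sum0[OF that] sum.lessThan_Suc_shift[of "\<lambda>l. (e j * cnj (e j')) ^ l" r] show ?thesis
      by (simp add: eq_neg_iff_add_eq_0 add.commute)
  qed
  ultimately have "punctured_hadamard r h" unfolding punctured_hadamard_def by blast
  then show ?thesis by blast
qed

section \<open>Real case: normalizing a Hadamard matrix\<close>

lemma real_hadamard_sum_rows:
  assumes H: "real_hadamard N H" and "i < N" "j < N"
  shows "(\<Sum>l<N. H $$ (i, l) * H $$ (j, l)) = (if i = j then real N else 0)"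
proof (cases "i = j")
  case True
  have "H $$ (i, l) * H $$ (i, l) = 1" if "l < N" for l
  proof -
    have "H $$ (i, l) = 1 \<or> H $$ (i, l) = - 1" using assms that by (simp add: real_hadamard_def)
    then show ?thesis by auto
  qed
  then show ?thesis using True assms(3) by simp
next
  case False
  then have "row H i \<bullet> row H j = 0" using assms by (simp add: real_hadamard_def)
  moreover have "H \<in> carrier_mat N N" using H by (simp add: real_hadamard_def)
  ultimately show ?thesis using assms(2,3) False
    by (simp add: scalar_prod_def lessThan_atLeast0)
qed

text \<open>Row orthogonality says that the transpose divided by \<open>N\<close> is a right inverse
  of \<open>H\<close>. For square matrices it is then also a left inverse, which is column
  orthogonality.\<close>

lemma real_hadamard_sum_cols:
  assumes H: "real_hadamard N H" and "i < N" "j < N"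
  shows "(\<Sum>l<N. H $$ (l, i) * H $$ (l, j)) = (if i = j then real N else 0)"
proof -
  have C: "H \<in> carrier_mat N N" using H by (simp add: real_hadamard_def)
  define K where "K = (1 / real N) \<cdot>\<^sub>m transpose_mat H"
  have K: "K \<in> carrier_mat N N" using C by (simp add: K_def)
  have "H * K = 1\<^sub>m N"
  proof (rule eq_matI)
    fix a b assume "a < dim_row (1\<^sub>m N :: real mat)" "b < dim_col (1\<^sub>m N :: real mat)"
    then have ab: "a < N" "b < N" by auto
    then have "(H * K) $$ (a, b) = (\<Sum>l<N. H $$ (a, l) * H $$ (b, l)) / real N"
      using C by (simp add: K_def scalar_prod_def lessThan_atLeast0 sum_divide_distrib)
    then show "(H * K) $$ (a, b) = 1\<^sub>m N $$ (a, b)"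
      using ab by (simp add: real_hadamard_sum_rows[OF H])
  qed (use C K in auto)
  then have "K * H = 1\<^sub>m N" by (rule mat_mult_left_right_inverse[OF C K])
  moreover have "(K * H) $$ (i, j) = (\<Sum>l<N. H $$ (l, i) * H $$ (l, j)) / real N"
    using C assms(2,3) by (simp add: K_def scalar_prod_def lessThan_atLeast0 sum_divide_distrib)
  ultimately show ?thesis using assms(2,3) by (auto split: if_splits)
qed

lemma punctured_hadamard_real:
  assumes H: "real_hadamard (r + 1) H"
  shows "\<exists>h :: nat \<Rightarrow> nat \<Rightarrow> real. punctured_hadamard r h"
proof -
  \<comment> \<open>Multiplying column \<open>j\<close> by \<open>H $$ (0, j)\<close> turns row \<open>0\<close> into the all-ones row.\<close>
  define h where "h = (\<lambda>i j. H $$ (Suc i, j) * H $$ (0, j))"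
  have pm: "H $$ (i, j) = 1 \<or> H $$ (i, j) = - 1" if "i < r + 1" "j < r + 1" for i j
    using H that by (simp add: real_hadamard_def)
  have sq: "H $$ (i, j) * H $$ (i, j) = 1" if "i < r + 1" "j < r + 1" for i j
    using pm[OF that] by auto
  have hh: "h i j = 1 \<or> h i j = - 1" if "i < r" "j < r + 1" for i j
    using pm[of "Suc i" j] pm[of 0 j] that by (auto simp: h_def)
  have "(\<Sum>j<r + 1. h i j * h i' j) = 0" if "i < r" "i' < r" "i \<noteq> i'" for i i'
  proof -
    have "(\<Sum>j<r + 1. h i j * h i' j) = (\<Sum>j<r + 1. H $$ (Suc i, j) * H $$ (Suc i', j))"
    proof (rule sum.cong[OF refl])
      fix j assume "j \<in> {..<r + 1}"
      then have "H $$ (0, j) * H $$ (0, j) = 1" using sq[of 0 j] by simp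
      moreover have "h i j * h i' j = (H $$ (0, j) * H $$ (0, j)) * (H $$ (Suc i, j) * H $$ (Suc i', j))"
        by (simp only: h_def mult_ac)
      ultimately show "h i j * h i' j = H $$ (Suc i, j) * H $$ (Suc i', j)" by simp
    qed
    then show ?thesis using real_hadamard_sum_rows[OF H, of "Suc i" "Suc i'"] that by simp
  qed
  moreover have "(\<Sum>j<r + 1. h i j) = 0" if "i < r" for i
    using real_hadamard_sum_rows[OF H, of "Suc i" 0] that by (simp add: h_def)
  moreover have "(\<Sum>i<r. h i j * h i j') = - 1" if "j < r + 1" "j' < r + 1" "j \<noteq> j'" for j j'
  proof -
    let ?p = "H $$ (0, j) * H $$ (0, j')"
    \<comment> \<open>The two full columns are orthogonal, so dropping row 0 leaves minus its term
      \<open>?p\<close>. Normalization multiplies this by \<open>?p\<close> again, and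
      \<open>?p * ?p = 1\<close>.\<close>
    have "(\<Sum>i<r. H $$ (Suc i, j) * H $$ (Suc i, j')) = - ?p"
      using real_hadamard_sum_cols[OF H that(1,2)] that(3)
        sum.lessThan_Suc_shift[of "\<lambda>i. H $$ (i, j) * H $$ (i, j')" r] by simp
    moreover have "(\<Sum>i<r. h i j * h i j') = ?p * (\<Sum>i<r. H $$ (Suc i, j) * H $$ (Suc i, j'))"
      unfolding sum_distrib_left by (simp add: h_def mult_ac)
    moreover have "?p * ?p = 1" using pm[of 0 j] pm[of 0 j'] that by auto
    ultimately show ?thesis by simp
  qed
  moreover have "norm (h i j) = 1 \<and> h i j * h i j = 1" if "i < r" "j < r + 1" for i j
    using hh[OF that] by auto
  ultimately have "punctured_hadamard r h"
    unfolding punctured_hadamard_def conjugate_real_def by simp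
  then show ?thesis by blast
qed

theorem theorem3p5:
  fixes V :: "'p set" and \<B> :: "'p set set" and v k r b :: nat
  assumes "2 \<le> k" and "k < v"
    and "bibd1 V \<B> v k"
    and "r = (v - 1) div (k - 1)"
    and "b = (v * (v - 1)) div (k * (k - 1))"
  shows "(\<exists>\<phi> :: nat \<Rightarrow> complex vec. centered_etf b (v * (r + 1)) \<phi>) \<and>
    ((\<exists>H. real_hadamard (r + 1) H) \<longrightarrow>
      (\<exists>\<phi> :: nat \<Rightarrow> real vec. centered_etf b (v * (r + 1)) \<phi>))"
proof -
  have b: "b = card \<B>" using bibd1_nblocks(1)[OF assms(3)] assms(5) by simp
  obtain h :: "nat \<Rightarrow> nat \<Rightarrow> complex" where h: "punctured_hadamard r h"
    using punctured_hadamard_fourier by blast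
  have "\<exists>\<phi> :: nat \<Rightarrow> complex vec. centered_etf b (v * (r + 1)) \<phi>"
    unfolding b by (rule steiner_centered_etf[OF assms(3,4) h]) simp
  moreover have "\<exists>\<phi> :: nat \<Rightarrow> real vec. centered_etf b (v * (r + 1)) \<phi>"
    if H: "real_hadamard (r + 1) H" for H
  proof -
    obtain h :: "nat \<Rightarrow> nat \<Rightarrow> real" where h: "punctured_hadamard r h"
      using punctured_hadamard_real[OF H] by blast
    show ?thesis
      unfolding b by (rule steiner_centered_etf[OF assms(3,4) h]) simp
  qed
  ultimately show ?thesis by blast
qed

end
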